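(* Let $T$ be a rooted, countably infinite and locally finite tree and let $S$ be the forward shift, regarded as a bounded operator either on $\mathcal{L}$ or on $\mathcal{L}_0$. Then, in either case, $\sigma(S)=\overline{\mathbb{D}}$. If $T$ is leafless, then $\sigma_{\mathrm{ap}}(S)=\partial\mathbb{D}$.
   Context: A tree is an undirected graph (no loops or multiple edges) in which any two vertices are joined by exactly one path; $T$ also denotes its vertex set. It is locally finite if every vertex has finite degree. $T$ has a distinguished vertex $o$, the root; $|v|$ is the length (number of edges) of the path from $o$ to $v$. For $v\neq o$, the parent $\mathrm{par}(v)$ is the vertex preceding $v$ on the unique path from $o$ to $v$; the vertices with parent $v$ are the children of $v$. A leaf is a vertex with no children; $T$ is leafless if it has no leaves. For $f:T\to\mathbb{C}$ define $f':T\to\mathbb{C}$ by $f'(o)=f(o)$ and $f'(v)=f(v)-f(\mathrm{par}(v))$ for $v\neq o$. The Lipschitz space $\mathcal{L}$ is the Banach space of all $f:T\to\mathbb{C}$ with $f'$ bounded, with norm $\|f\|=\sup_{v\in T}|f'(v)|$. The little Lipschitz space $\mathcal{L}_0$ is the closed subspace of all $f$ with $\lim_{|v|\to\infty}f'(v)=0$, with the same norm. The forward shift is defined on functions $f:T\to\mathbb{C}$ by $(Sf)(o)=0$ and $(Sf)(v)=f(\mathrm{par}(v))$ for $v\ne o$; it is bounded on both spaces. $\mathbb{D}$ is the open unit disk in $\mathbb{C}$; $\sigma$ is the spectrum and $\sigma_{\mathrm{ap}}$ the approximate point spectrum (the set of $\lambda$ such that $S-\lambda$ is not bounded below). *)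

theory Defs
  imports "HOL-Analysis.Analysis"
begin

text \<open>A tree is given by its adjacency relation; its vertex set is the whole type \<open>'v\<close>.\<close>

definition tree_path :: "('v \<Rightarrow> 'v \<Rightarrow> bool) \<Rightarrow> 'v \<Rightarrow> 'v \<Rightarrow> 'v list \<Rightarrow> bool" where
  "tree_path E u v p \<longleftrightarrow>
     p \<noteq> [] \<and> hd p = u \<and> last p = v \<and> distinct p \<and> successively E p"

definition is_tree :: "('v \<Rightarrow> 'v \<Rightarrow> bool) \<Rightarrow> bool" where
  "is_tree E \<longleftrightarrow> symp E \<and> irreflp E \<and> (\<forall>u v. \<exists>!p. tree_path E u v p)"

definition locally_finite :: "('v \<Rightarrow> 'v \<Rightarrow> bool) \<Rightarrow> bool" where
  "locally_finite E \<longleftrightarrow> (\<forall>v. finite {w. E v w})"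

definition root_path :: "('v \<Rightarrow> 'v \<Rightarrow> bool) \<Rightarrow> 'v \<Rightarrow> 'v \<Rightarrow> 'v list" where
  "root_path E r v = (THE p. tree_path E r v p)"

text \<open>A path is the list of its vertices, so it has one edge fewer than list elements.\<close>

definition depth :: "('v \<Rightarrow> 'v \<Rightarrow> bool) \<Rightarrow> 'v \<Rightarrow> 'v \<Rightarrow> nat" where
  "depth E r v = length (root_path E r v) - 1"

text \<open>The value at the root is irrelevant.\<close>

definition parent :: "('v \<Rightarrow> 'v \<Rightarrow> bool) \<Rightarrow> 'v \<Rightarrow> 'v \<Rightarrow> 'v" where
  "parent E r v = last (butlast (root_path E r v))"

definition children :: "('v \<Rightarrow> 'v \<Rightarrow> bool) \<Rightarrow> 'v \<Rightarrow> 'v \<Rightarrow> 'v set" where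
  "children E r v = {w. w \<noteq> r \<and> parent E r w = v}"

definition leafless :: "('v \<Rightarrow> 'v \<Rightarrow> bool) \<Rightarrow> 'v \<Rightarrow> bool" where
  "leafless E r \<longleftrightarrow> (\<forall>v. children E r v \<noteq> {})"

definition tree_deriv ::
  "('v \<Rightarrow> 'v \<Rightarrow> bool) \<Rightarrow> 'v \<Rightarrow> ('v \<Rightarrow> complex) \<Rightarrow> 'v \<Rightarrow> complex" where
  "tree_deriv E r f v = (if v = r then f r else f v - f (parent E r v))"

definition Lipschitz_space :: "('v \<Rightarrow> 'v \<Rightarrow> bool) \<Rightarrow> 'v \<Rightarrow> ('v \<Rightarrow> complex) set" where
  "Lipschitz_space E r = {f. bounded (range (tree_deriv E r f))}"

definition Lipschitz_norm :: "('v \<Rightarrow> 'v \<Rightarrow> bool) \<Rightarrow> 'v \<Rightarrow> ('v \<Rightarrow> complex) \<Rightarrow> real" where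
  "Lipschitz_norm E r f = (SUP v. norm (tree_deriv E r f v))"

text \<open>The filter \<open>filtercomap (depth E r) at_top\<close> expresses \<open>|v| \<rightarrow> \<infinity>\<close>.\<close>

definition little_Lipschitz_space :: "('v \<Rightarrow> 'v \<Rightarrow> bool) \<Rightarrow> 'v \<Rightarrow> ('v \<Rightarrow> complex) set" where
  "little_Lipschitz_space E r =
     {f \<in> Lipschitz_space E r. (tree_deriv E r f \<longlongrightarrow> 0) (filtercomap (depth E r) at_top)}"

definition forward_shift ::
  "('v \<Rightarrow> 'v \<Rightarrow> bool) \<Rightarrow> 'v \<Rightarrow> ('v \<Rightarrow> complex) \<Rightarrow> 'v \<Rightarrow> complex" where
  "forward_shift E r f v = (if v = r then 0 else f (parent E r v))"

text \<open>
  The spaces depend on the tree, hence are not types. Operators are studied on a normed space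
  given by a carrier \<open>X\<close>, a linear subspace of \<open>'v \<Rightarrow> complex\<close>, and a norm \<open>N\<close> on \<open>X\<close>;
  only the values of operators on \<open>X\<close> matter.
\<close>

definition bounded_operator_on ::
  "('v \<Rightarrow> complex) set \<Rightarrow> (('v \<Rightarrow> complex) \<Rightarrow> real) \<Rightarrow>
   (('v \<Rightarrow> complex) \<Rightarrow> 'v \<Rightarrow> complex) \<Rightarrow> bool" where
  "bounded_operator_on X N A \<longleftrightarrow>
     (\<forall>f\<in>X. A f \<in> X) \<and>
     (\<forall>f\<in>X. \<forall>g\<in>X. \<forall>a b. A (\<lambda>v. a * f v + b * g v) = (\<lambda>v. a * A f v + b * A g v)) \<and>
     (\<exists>K. \<forall>f\<in>X. N (A f) \<le> K * N f)"

definition minus_scalar ::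
  "(('v \<Rightarrow> complex) \<Rightarrow> 'v \<Rightarrow> complex) \<Rightarrow> complex \<Rightarrow> ('v \<Rightarrow> complex) \<Rightarrow> 'v \<Rightarrow> complex" where
  "minus_scalar A z f v = A f v - z * f v"

definition spectrum_on ::
  "('v \<Rightarrow> complex) set \<Rightarrow> (('v \<Rightarrow> complex) \<Rightarrow> real) \<Rightarrow>
   (('v \<Rightarrow> complex) \<Rightarrow> 'v \<Rightarrow> complex) \<Rightarrow> complex set" where
  "spectrum_on X N A =
     {z. \<not> (\<exists>B. bounded_operator_on X N B \<and>
                (\<forall>f\<in>X. B (minus_scalar A z f) = f \<and> minus_scalar A z (B f) = f))}"

definition bounded_below_on ::
  "('v \<Rightarrow> complex) set \<Rightarrow> (('v \<Rightarrow> complex) \<Rightarrow> real) \<Rightarrow>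
   (('v \<Rightarrow> complex) \<Rightarrow> 'v \<Rightarrow> complex) \<Rightarrow> bool" where
  "bounded_below_on X N A \<longleftrightarrow> (\<exists>c>0. \<forall>f\<in>X. c * N f \<le> N (A f))"

definition approx_point_spectrum_on ::
  "('v \<Rightarrow> complex) set \<Rightarrow> (('v \<Rightarrow> complex) \<Rightarrow> real) \<Rightarrow>
   (('v \<Rightarrow> complex) \<Rightarrow> 'v \<Rightarrow> complex) \<Rightarrow> complex set" where
  "approx_point_spectrum_on X N A = {z. \<not> bounded_below_on X N (minus_scalar A z)}"

lemma root_path: "is_tree E \<Longrightarrow> tree_path E r v (root_path E r v)"
  unfolding is_tree_def root_path_def by (metis theI')

lemma root_path_eqI: "is_tree E \<Longrightarrow> tree_path E r v p \<Longrightarrow> root_path E r v = p"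
  unfolding is_tree_def root_path_def by (metis the1_equality)

lemma root_path_parent:
  assumes "is_tree E" "v \<noteq> r"
  shows "root_path E r v = root_path E r (parent E r v) @ [v]"
proof -
  let ?p = "root_path E r v"
  have p: "tree_path E r v ?p" by (rule root_path[OF assms(1)])
  have eq: "?p = butlast ?p @ [v]"
    using p unfolding tree_path_def by (metis append_butlast_last_id)
  have ne: "butlast ?p \<noteq> []"
    using p assms(2) eq unfolding tree_path_def by (metis append_Nil list.sel(1))
  have "hd (butlast ?p) = r"
    using p ne eq unfolding tree_path_def by (metis hd_append2)
  moreover have "distinct (butlast ?p @ [v])" "successively E (butlast ?p @ [v])"
    using p eq unfolding tree_path_def by simp_all
  ultimately have "tree_path E r (parent E r v) (butlast ?p)"
    using ne unfolding tree_path_def parent_def by (simp add: successively_append_iff)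
  then show ?thesis using root_path_eqI[OF assms(1)] eq by metis
qed

lemma depth_parent:
  assumes "is_tree E" "v \<noteq> r"
  shows "depth E r v = Suc (depth E r (parent E r v))"
proof -
  have "root_path E r (parent E r v) \<noteq> []"
    using root_path[OF assms(1)] unfolding tree_path_def by blast
  then show ?thesis using root_path_parent[OF assms] unfolding depth_def by simp
qed

lemma parent_adjacent:
  assumes "is_tree E" "v \<noteq> r"
  shows "E (parent E r v) v"
  using root_path[OF assms(1), of r v] root_path[OF assms(1), of r "parent E r v"]
  by (simp add: root_path_parent[OF assms] tree_path_def successively_append_iff)

lemma tree_deriv_linear:
  "tree_deriv E r (\<lambda>v. a * f v + b * g v) v = a * tree_deriv E r f v + b * tree_deriv E r g v"
  by (simp add: tree_deriv_def algebra_simps)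

lemma tree_deriv_forward_shift:
  "tree_deriv E r (forward_shift E r f) v = (if v = r then 0 else tree_deriv E r f (parent E r v))"
  by (simp add: tree_deriv_def forward_shift_def)

lemma norm_tree_deriv_le:
  assumes "f \<in> Lipschitz_space E r"
  shows "norm (tree_deriv E r f v) \<le> Lipschitz_norm E r f"
proof -
  have "bdd_above (range (\<lambda>v. norm (tree_deriv E r f v)))"
    using assms unfolding Lipschitz_space_def bounded_iff bdd_above_def by auto
  then show ?thesis unfolding Lipschitz_norm_def by (rule cSUP_upper[rotated]) simp
qed

lemma Lipschitz_norm_le:
  "(\<And>v. norm (tree_deriv E r f v) \<le> K) \<Longrightarrow> Lipschitz_norm E r f \<le> K"
  unfolding Lipschitz_norm_def by (rule cSUP_least) auto

lemma Lipschitz_norm_eq_0: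
  assumes "is_tree E" "f \<in> Lipschitz_space E r" "Lipschitz_norm E r f = 0"
  shows "f v = 0"
proof (induction "depth E r v" arbitrary: v rule: less_induct)
  case less
  have d: "tree_deriv E r f v = 0" using norm_tree_deriv_le[OF assms(2), of v] assms(3) by simp
  show ?case
  proof (cases "v = r")
    case False
    then show ?thesis
      using d less depth_parent[OF assms(1) False] by (simp add: tree_deriv_def)
  qed (use d in \<open>simp add: tree_deriv_def\<close>)
qed

lemma Lipschitz_space_linear:
  assumes "f \<in> Lipschitz_space E r" "g \<in> Lipschitz_space E r"
  shows "(\<lambda>v. a * f v + b * g v) \<in> Lipschitz_space E r"
proof -
  have "norm (tree_deriv E r (\<lambda>v. a * f v + b * g v) v)
      \<le> norm a * Lipschitz_norm E r f + norm b * Lipschitz_norm E r g" for v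
    unfolding tree_deriv_linear
    by (rule norm_triangle_le)
      (auto simp: norm_mult intro!: add_mono mult_left_mono norm_tree_deriv_le assms)
  then have "bounded (range (tree_deriv E r (\<lambda>v. a * f v + b * g v)))"
    by (intro boundedI) blast
  then show ?thesis by (simp add: Lipschitz_space_def)
qed

lemma little_Lipschitz_space_linear:
  assumes "f \<in> little_Lipschitz_space E r" "g \<in> little_Lipschitz_space E r"
  shows "(\<lambda>v. a * f v + b * g v) \<in> little_Lipschitz_space E r"
proof -
  have "((\<lambda>v. a * tree_deriv E r f v + b * tree_deriv E r g v) \<longlongrightarrow> a * 0 + b * 0)
      (filtercomap (depth E r) at_top)"
    using assms unfolding little_Lipschitz_space_def by (intro tendsto_intros) auto
  moreover have "tree_deriv E r (\<lambda>v. a * f v + b * g v) =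
      (\<lambda>v. a * tree_deriv E r f v + b * tree_deriv E r g v)"
    by (rule ext) (rule tree_deriv_linear)
  ultimately show ?thesis
    using assms Lipschitz_space_linear[of f E r g a b] unfolding little_Lipschitz_space_def by simp
qed

lemma norm_tree_deriv_forward_shift_le:
  assumes "f \<in> Lipschitz_space E r"
  shows "norm (tree_deriv E r (forward_shift E r f) v) \<le> Lipschitz_norm E r f"
  using norm_tree_deriv_le[OF assms, of "parent E r v"]
    order_trans[OF norm_ge_zero norm_tree_deriv_le[OF assms]]
  by (simp add: tree_deriv_forward_shift)

lemma forward_shift_Lipschitz_space:
  assumes "f \<in> Lipschitz_space E r"
  shows "forward_shift E r f \<in> Lipschitz_space E r"
proof -
  have "bounded (range (tree_deriv E r (forward_shift E r f)))"
    by (rule boundedI[of _ "Lipschitz_norm E r f"])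
      (auto intro: norm_tree_deriv_forward_shift_le[OF assms])
  then show ?thesis by (simp add: Lipschitz_space_def)
qed

lemma forward_shift_little_Lipschitz_space:
  assumes "is_tree E" "f \<in> little_Lipschitz_space E r"
  shows "forward_shift E r f \<in> little_Lipschitz_space E r"
proof -
  have "(tree_deriv E r (forward_shift E r f) \<longlongrightarrow> 0) (filtercomap (depth E r) at_top)"
  proof (rule tendstoI)
    fix e :: real assume e: "e > 0"
    have "eventually (\<lambda>v. dist (tree_deriv E r f v) 0 < e) (filtercomap (depth E r) at_top)"
      using assms(2) e tendstoD unfolding little_Lipschitz_space_def by blast
    then obtain n where n: "\<And>v. depth E r v \<ge> n \<Longrightarrow> dist (tree_deriv E r f v) 0 < e"
      unfolding eventually_filtercomap eventually_at_top_linorder by blast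
    have "dist (tree_deriv E r (forward_shift E r f) v) 0 < e" if "depth E r v \<ge> Suc n" for v
      using that n[of "parent E r v"] depth_parent[OF assms(1), of v r] e
      by (auto simp: tree_deriv_forward_shift)
    then show "eventually (\<lambda>v. dist (tree_deriv E r (forward_shift E r f) v) 0 < e)
        (filtercomap (depth E r) at_top)"
      unfolding eventually_filtercomap eventually_at_top_linorder by blast
  qed
  then show ?thesis
    using assms(2) forward_shift_Lipschitz_space[of f E r]
    by (simp add: little_Lipschitz_space_def)
qed

lemma bounded_operator_forward_shift:
  "bounded_operator_on (Lipschitz_space E r) (Lipschitz_norm E r) (forward_shift E r)"
proof -
  have "Lipschitz_norm E r (forward_shift E r f) \<le> 1 * Lipschitz_norm E r f"
    if "f \<in> Lipschitz_space E r" for f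
    using Lipschitz_norm_le[OF norm_tree_deriv_forward_shift_le[OF that]] by simp
  moreover have "forward_shift E r (\<lambda>v. a * f v + b * g v) =
      (\<lambda>v. a * forward_shift E r f v + b * forward_shift E r g v)" for a b f g
    by (simp add: forward_shift_def fun_eq_iff)
  ultimately show ?thesis
    unfolding bounded_operator_on_def by (blast intro: forward_shift_Lipschitz_space)
qed

lemma bounded_operator_forward_shift_little:
  assumes "is_tree E"
  shows "bounded_operator_on (little_Lipschitz_space E r) (Lipschitz_norm E r) (forward_shift E r)"
proof -
  have "f \<in> Lipschitz_space E r" if "f \<in> little_Lipschitz_space E r" for f
    using that by (simp add: little_Lipschitz_space_def)
  then show ?thesis
    using bounded_operator_forward_shift[of E r] forward_shift_little_Lipschitz_space[OF assms, of _ r]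
    unfolding bounded_operator_on_def by meson
qed

end

theory Submission imports Defs begin

text \<open>
  The derivative \<open>f \<mapsto> f'\<close> commutes with the forward shift \<open>S\<close>, and a function is recovered from
  its derivative by summation along the path from the root. Thus \<open>S\<close> on the Lipschitz space or
  its little subspace behaves like the same shift \<open>g \<mapsto> g \<circ> par\<close> (with value \<open>0\<close> at the root) on the
  bounded functions, respectively on those vanishing at infinity, with the supremum norm. All
  estimates are made there.

  If \<open>|z| > 1\<close>, the equation \<open>(S - z) f = h\<close> can be solved for \<open>f\<close> vertex by vertex, starting at
  the root, and the factor \<open>1 / |z| < 1\<close> in this recursion keeps the solution bounded by
  \<open>\<parallel>h\<parallel> / (|z| - 1)\<close> and carries decay of \<open>h'\<close> over to \<open>f'\<close>; so \<open>z\<close> is not in the spectrum.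

  If \<open>0 < |z| \<le> 1\<close>, take \<open>h\<close> in the little space such that the contributions of the ancestors of \<open>v\<close>
  in that recursion are aligned and have size at least \<open>1, 1/2, 1/3, \<dots>\<close>. A solution
  of \<open>(S - z) f = h\<close> would have \<open>f'\<close> at least as large as the harmonic numbers, and a locally
  finite infinite tree has vertices of arbitrary depth, so \<open>f\<close> would not be Lipschitz. Hence
  \<open>S - z\<close> is not surjective on either space. For \<open>z = 0\<close> it is not surjective because \<open>S f\<close>
  vanishes at the root.

  For the approximate point spectrum, \<open>S\<close> does not increase the norm, and on a leafless tree it
  is an isometry, because each value of \<open>f'\<close> reappears at a child. By the
  triangle inequality \<open>\<parallel>(S - z) f\<parallel>\<close> is at least \<open>(|z| - 1) \<parallel>f\<parallel>\<close> for \<open>|z| > 1\<close>, and on a leafless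
  tree at least \<open>(1 - |z|) \<parallel>f\<parallel>\<close> for \<open>|z| < 1\<close>. On the unit circle the formal
  eigenfunction \<open>g v = z ^ (-|v|)\<close> of the shift, multiplied by a slowly varying tent function of
  the depth, gives approximate eigenvectors.
\<close>

section \<open>Functions on rooted trees\<close>

lemma root_path_root: "is_tree E \<Longrightarrow> root_path E r r = [r]"
  by (rule root_path_eqI) (simp_all add: tree_path_def)

lemma depth_root: "is_tree E \<Longrightarrow> depth E r r = 0"
  by (simp add: depth_def root_path_root)

lemma tree_induct [consumes 1, case_names root step]:
  assumes "is_tree E"
    and "P r"
    and "\<And>v. v \<noteq> r \<Longrightarrow> P (parent E r v) \<Longrightarrow> P v"
  shows "P v"
proof (induction "depth E r v" arbitrary: v rule: less_induct)
  case less
  then show ?case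
    using assms depth_parent[OF assms(1)] by (cases "v = r") auto
qed

lemma finite_depth_le:
  assumes "is_tree E" "locally_finite E"
  shows "finite {v. depth E r v \<le> n}"
proof (induction n)
  case 0
  have "{v. depth E r v \<le> 0} \<subseteq> {r}"
    using depth_parent[OF assms(1)] by fastforce
  then show ?case by (rule finite_subset) simp
next
  case (Suc n)
  have "{v. depth E r v \<le> Suc n} \<subseteq> {r} \<union> (\<Union>u\<in>{v. depth E r v \<le> n}. {w. E u w})"
  proof
    fix v assume v: "v \<in> {v. depth E r v \<le> Suc n}"
    show "v \<in> {r} \<union> (\<Union>u\<in>{v. depth E r v \<le> n}. {w. E u w})"
    proof (cases "v = r")
      case False
      then show ?thesis
        using v depth_parent[OF assms(1) False] parent_adjacent[OF assms(1) False] by auto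
    qed simp
  qed
  then show ?case
    by (rule finite_subset) (use Suc assms(2) in \<open>auto simp: locally_finite_def\<close>)
qed

lemma depth_unbounded:
  fixes E :: "'v \<Rightarrow> 'v \<Rightarrow> bool"
  assumes "is_tree E" "locally_finite E" "infinite (UNIV :: 'v set)"
  obtains v where "n < depth E r v"
proof -
  have "{v. depth E r v \<le> n} \<noteq> UNIV"
    using finite_depth_le[OF assms(1,2), of r n] assms(3) by metis
  then obtain v where "\<not> depth E r v \<le> n" by blast
  then show thesis using that[of v] by simp
qed

lemma tendsto_0_depth_iff:
  fixes g :: "'v \<Rightarrow> complex"
  shows "(g \<longlongrightarrow> 0) (filtercomap (depth E r) at_top) \<longleftrightarrow>
    (\<forall>e>0. \<exists>n. \<forall>v. n \<le> depth E r v \<longrightarrow> norm (g v) < e)"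
  unfolding tendsto_iff eventually_filtercomap eventually_at_top_linorder dist_norm diff_0_right
  by blast

definition path_sum :: "('v \<Rightarrow> 'v \<Rightarrow> bool) \<Rightarrow> 'v \<Rightarrow> ('v \<Rightarrow> complex) \<Rightarrow> 'v \<Rightarrow> complex" where
  "path_sum E r g v = (\<Sum>w\<leftarrow>root_path E r v. g w)"

lemma tree_deriv_path_sum:
  assumes "is_tree E"
  shows "tree_deriv E r (path_sum E r g) = g"
proof
  fix v
  show "tree_deriv E r (path_sum E r g) v = g v"
    using root_path_root[OF assms, of r] root_path_parent[OF assms, of v r]
    by (cases "v = r") (simp_all add: tree_deriv_def path_sum_def)
qed

lemma little_subset_Lipschitz_space: "little_Lipschitz_space E r \<subseteq> Lipschitz_space E r"
  by (auto simp: little_Lipschitz_space_def)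

lemma Lipschitz_norm_nonneg: "f \<in> Lipschitz_space E r \<Longrightarrow> 0 \<le> Lipschitz_norm E r f"
  using norm_tree_deriv_le[of f E r r] norm_ge_zero order_trans by blast

lemma Lipschitz_spaceI: "(\<And>v. norm (tree_deriv E r f v) \<le> K) \<Longrightarrow> f \<in> Lipschitz_space E r"
  unfolding Lipschitz_space_def by (auto intro: boundedI)

lemma path_sum_in_little_Lipschitz_space:
  assumes "is_tree E"
    and "\<And>v. norm (g v) \<le> K"
    and "\<And>e. 0 < e \<Longrightarrow> \<exists>n. \<forall>v. n \<le> depth E r v \<longrightarrow> norm (g v) < e"
  shows "path_sum E r g \<in> little_Lipschitz_space E r"
  using assms Lipschitz_spaceI[of E r "path_sum E r g" K]
  by (simp add: little_Lipschitz_space_def tree_deriv_path_sum tendsto_0_depth_iff)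

lemma tree_deriv_minus_scalar_forward_shift:
  "tree_deriv E r (minus_scalar (forward_shift E r) z f) =
    minus_scalar (forward_shift E r) z (tree_deriv E r f)"
  by (auto simp: fun_eq_iff tree_deriv_def minus_scalar_def forward_shift_def algebra_simps)

lemma minus_scalar_forward_shift_Lipschitz:
  assumes "f \<in> Lipschitz_space E r"
  shows "minus_scalar (forward_shift E r) z f \<in> Lipschitz_space E r"
  using Lipschitz_space_linear[OF forward_shift_Lipschitz_space[OF assms] assms, of 1 "- z"]
  by (simp add: minus_scalar_def[abs_def])

section \<open>The resolvent outside the closed disk\<close>

text \<open>
  The equation \<open>(S - z) f = h\<close> says \<open>f v = (f (par v) - h v) / z\<close>, where \<open>f (par v)\<close> is read as \<open>0\<close>
  at the root; it can be unrolled along the path from the root.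
\<close>
definition shift_resolvent ::
  "('v \<Rightarrow> 'v \<Rightarrow> bool) \<Rightarrow> 'v \<Rightarrow> complex \<Rightarrow> ('v \<Rightarrow> complex) \<Rightarrow> 'v \<Rightarrow> complex" where
  "shift_resolvent E r z h v = foldl (\<lambda>a w. (a - h w) / z) 0 (root_path E r v)"

lemma minus_scalar_shift_resolvent:
  assumes "is_tree E" "z \<noteq> 0"
  shows "minus_scalar (forward_shift E r) z (shift_resolvent E r z h) = h"
proof
  fix v
  show "minus_scalar (forward_shift E r) z (shift_resolvent E r z h) v = h v"
    using assms(2) root_path_root[OF assms(1), of r] root_path_parent[OF assms(1), of v r]
    by (cases "v = r") (simp_all add: minus_scalar_def forward_shift_def shift_resolvent_def)
qed

lemma minus_scalar_forward_shift_inj: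
  assumes "is_tree E" "z \<noteq> 0"
    and eq: "minus_scalar (forward_shift E r) z f = minus_scalar (forward_shift E r) z g"
  shows "f = g"
proof
  fix v
  note eqv = fun_cong[OF eq, unfolded minus_scalar_def forward_shift_def]
  show "f v = g v"
    using assms(1)
  proof (induction v rule: tree_induct[where r = r])
    case root
    then show ?case using eqv[of r] assms(2) by simp
  next
    case (step v)
    then show ?case using eqv[of v] assms(2) by simp
  qed
qed

lemma shift_resolvent_minus_scalar:
  assumes "is_tree E" "z \<noteq> 0"
  shows "shift_resolvent E r z (minus_scalar (forward_shift E r) z f) = f"
  by (rule minus_scalar_forward_shift_inj[OF assms]) (rule minus_scalar_shift_resolvent[OF assms])

lemma shift_resolvent_linear:
  assumes "is_tree E" "z \<noteq> 0"
  shows "shift_resolvent E r z (\<lambda>v. a * f v + b * g v) =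
    (\<lambda>v. a * shift_resolvent E r z f v + b * shift_resolvent E r z g v)" (is "?L = ?R")
proof (rule minus_scalar_forward_shift_inj[OF assms])
  have "minus_scalar (forward_shift E r) z ?R = (\<lambda>v.
      a * minus_scalar (forward_shift E r) z (shift_resolvent E r z f) v +
      b * minus_scalar (forward_shift E r) z (shift_resolvent E r z g) v)"
    by (auto simp: fun_eq_iff minus_scalar_def forward_shift_def algebra_simps)
  then show "minus_scalar (forward_shift E r) z ?L = minus_scalar (forward_shift E r) z ?R"
    by (simp add: minus_scalar_shift_resolvent[OF assms])
qed

lemma minus_scalar_shift_norm_step:
  assumes "1 < norm z" "norm (minus_scalar (forward_shift E r) z g v) \<le> M"
  shows "norm (g v) \<le> (norm (forward_shift E r g v) + M) / norm z"
proof -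
  have "norm (z * g v) =
      norm (forward_shift E r g v - minus_scalar (forward_shift E r) z g v)"
    by (simp add: minus_scalar_def)
  also have "\<dots> \<le> norm (forward_shift E r g v) + M"
    using assms(2) norm_triangle_ineq4 by (meson add_left_mono order_trans)
  finally show ?thesis
    using assms(1) by (subst pos_le_divide_eq) (auto simp: norm_mult mult.commute)
qed

text \<open>
  The bound \<open>M / (|z| - 1)\<close> is the fixed point of the map \<open>x \<mapsto> (x + M) / |z|\<close> that governs the
  passage from a vertex to its children.
\<close>
lemma minus_scalar_shift_bound:
  assumes "is_tree E" "1 < norm z"
    and k: "\<And>v. norm (minus_scalar (forward_shift E r) z g v) \<le> M"
  shows "norm (g v) \<le> M / (norm z - 1)"
proof -
  have M: "0 \<le> M" using k[of v] norm_ge_zero order_trans by blast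
  have fixpoint: "(M / (norm z - 1) + M) / norm z = M / (norm z - 1)"
    using assms(2) by (auto simp: divide_simps algebra_simps)
  have bound: "norm (g v) \<le> M / (norm z - 1)"
    if "norm (forward_shift E r g v) \<le> M / (norm z - 1)" for v
  proof -
    have "norm (g v) \<le> (norm (forward_shift E r g v) + M) / norm z"
      by (rule minus_scalar_shift_norm_step[OF assms(2) k])
    also have "\<dots> \<le> (M / (norm z - 1) + M) / norm z"
      using that by (intro divide_right_mono) auto
    finally show ?thesis by (simp add: fixpoint)
  qed
  show ?thesis
    using assms(1)
  proof (induction v rule: tree_induct[where r = r])
    case root
    show ?case using M assms(2) by (intro bound) (simp add: forward_shift_def)
  next
    case (step v)
    then show ?case by (intro bound) (simp add: forward_shift_def)
  qed
qed

text \<open>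
  From the depth on where \<open>|(S - z) g|\<close> stays below a small \<open>d\<close>, the excess of \<open>|g v|\<close> over the fixed
  point \<open>d / (|z| - 1)\<close> shrinks at least by the factor \<open>1 / |z|\<close> at each step.
\<close>
lemma minus_scalar_shift_decay:
  assumes "is_tree E" "1 < norm z"
    and k: "\<And>v. norm (minus_scalar (forward_shift E r) z g v) \<le> M"
    and lim: "(minus_scalar (forward_shift E r) z g \<longlongrightarrow> 0) (filtercomap (depth E r) at_top)"
  shows "(g \<longlongrightarrow> 0) (filtercomap (depth E r) at_top)"
  unfolding tendsto_0_depth_iff
proof (intro allI impI)
  fix e :: real assume e: "0 < e"
  define q where "q = inverse (norm z)"
  have q: "0 < q" "q < 1" using assms(2) by (auto simp: q_def intro: inverse_less_1_iff[THEN iffD2])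
  \<comment> \<open>The fixed point that belongs to \<open>d\<close> is \<open>e / 2\<close>.\<close>
  define d where "d = e / 2 * (norm z - 1)"
  have d: "0 < d" using e assms(2) by (simp add: d_def)
  define B where "B = M / (norm z - 1)"
  have gB: "norm (g v) \<le> B" for v
    unfolding B_def by (rule minus_scalar_shift_bound[OF assms(1,2) k])
  obtain n where n: "\<And>v. n \<le> depth E r v \<Longrightarrow> norm (minus_scalar (forward_shift E r) z g v) < d"
    using lim d unfolding tendsto_0_depth_iff by blast
  have decay: "norm (g v) \<le> B * q ^ m + e / 2" if "depth E r v = n + m" for m v
    using that
  proof (induction m arbitrary: v)
    case 0
    then show ?case using gB[of v] e by simp
  next
    case (Suc m)
    then have v: "v \<noteq> r" using depth_root[OF assms(1)] by auto
    have IH: "norm (g (parent E r v)) \<le> B * q ^ m + e / 2"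
      using Suc depth_parent[OF assms(1) v] by simp
    have "norm (g v) \<le> (norm (forward_shift E r g v) + d) / norm z"
      using Suc.prems by (intro minus_scalar_shift_norm_step[OF assms(2)] less_imp_le n) simp
    also have "\<dots> \<le> (B * q ^ m + e / 2 + d) / norm z"
      using IH v by (intro divide_right_mono) (auto simp: forward_shift_def)
    also have "B * q ^ m + e / 2 + d = B * q ^ m + e / 2 * norm z"
      by (simp add: d_def right_diff_distrib)
    also have "\<dots> / norm z = B * q ^ Suc m + e / 2"
    proof -
      have "norm z \<noteq> 0" using assms(2) by linarith
      then have "norm z * q = 1" by (simp add: q_def)
      then show ?thesis
        unfolding divide_inverse[of _ "norm z"] q_def[symmetric] power_Suc by algebra
    qed
    finally show ?case .
  qed
  have "(\<lambda>m. B * q ^ m) \<longlonglongrightarrow> 0"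
    using q by (intro tendsto_mult_right_zero LIMSEQ_realpow_zero) auto
  then have "eventually (\<lambda>m. B * q ^ m < e / 2) sequentially"
    by (rule order_tendstoD) (use e in simp)
  then obtain m0 where m0: "\<And>m. m0 \<le> m \<Longrightarrow> B * q ^ m < e / 2"
    unfolding eventually_sequentially by blast
  show "\<exists>n. \<forall>v. n \<le> depth E r v \<longrightarrow> norm (g v) < e"
  proof (intro exI allI impI)
    fix v assume v: "n + m0 \<le> depth E r v"
    have "norm (g v) \<le> B * q ^ (depth E r v - n) + e / 2" using v by (intro decay) simp
    also have "\<dots> < e" using m0[of "depth E r v - n"] v by linarith
    finally show "norm (g v) < e" .
  qed
qed

lemma minus_scalar_tree_deriv_shift_resolvent:
  assumes "is_tree E" "z \<noteq> 0"
  shows "minus_scalar (forward_shift E r) z (tree_deriv E r (shift_resolvent E r z h)) =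
    tree_deriv E r h"
  by (metis tree_deriv_minus_scalar_forward_shift minus_scalar_shift_resolvent[OF assms])

lemma norm_tree_deriv_shift_resolvent_le:
  assumes "is_tree E" "1 < norm z" "h \<in> Lipschitz_space E r"
  shows "norm (tree_deriv E r (shift_resolvent E r z h) v) \<le> Lipschitz_norm E r h / (norm z - 1)"
proof (rule minus_scalar_shift_bound[OF assms(1,2)])
  have "z \<noteq> 0" using assms(2) by auto
  then show "norm (minus_scalar (forward_shift E r) z
      (tree_deriv E r (shift_resolvent E r z h)) v) \<le> Lipschitz_norm E r h" for v
    by (simp add: minus_scalar_tree_deriv_shift_resolvent[OF assms(1)]
        norm_tree_deriv_le[OF assms(3)])
qed

lemma shift_resolvent_in_space:
  assumes "is_tree E" "1 < norm z"
    and X: "X \<in> {Lipschitz_space E r, little_Lipschitz_space E r}" and h: "h \<in> X"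
  shows "shift_resolvent E r z h \<in> X"
proof -
  have z: "z \<noteq> 0" using assms(2) by auto
  have h': "h \<in> Lipschitz_space E r"
    using X h little_subset_Lipschitz_space[of E r] by auto
  have eq: "minus_scalar (forward_shift E r) z (tree_deriv E r (shift_resolvent E r z h)) =
      tree_deriv E r h"
    by (rule minus_scalar_tree_deriv_shift_resolvent[OF assms(1) z])
  have L: "shift_resolvent E r z h \<in> Lipschitz_space E r"
    by (rule Lipschitz_spaceI[OF norm_tree_deriv_shift_resolvent_le[OF assms(1,2) h']])
  have "(tree_deriv E r (shift_resolvent E r z h) \<longlongrightarrow> 0) (filtercomap (depth E r) at_top)"
    if "h \<in> little_Lipschitz_space E r"
  proof (rule minus_scalar_shift_decay[OF assms(1,2)])
    show "norm (minus_scalar (forward_shift E r) z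
        (tree_deriv E r (shift_resolvent E r z h)) v) \<le> Lipschitz_norm E r h" for v
      unfolding eq by (rule norm_tree_deriv_le[OF h'])
    show "(minus_scalar (forward_shift E r) z (tree_deriv E r (shift_resolvent E r z h)) \<longlongrightarrow> 0)
        (filtercomap (depth E r) at_top)"
      unfolding eq using that by (simp add: little_Lipschitz_space_def)
  qed
  then show ?thesis
    using X h L by (auto simp: little_Lipschitz_space_def)
qed

lemma not_in_spectrum_outside_disk:
  assumes "is_tree E" "1 < norm z"
    and X: "X \<in> {Lipschitz_space E r, little_Lipschitz_space E r}"
  shows "z \<notin> spectrum_on X (Lipschitz_norm E r) (forward_shift E r)"
proof -
  have z: "z \<noteq> 0" using assms(2) by auto
  have "Lipschitz_norm E r (shift_resolvent E r z h) \<le> 1 / (norm z - 1) * Lipschitz_norm E r h"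
    if "h \<in> X" for h
  proof -
    have "h \<in> Lipschitz_space E r"
      using X that little_subset_Lipschitz_space[of E r] by auto
    from Lipschitz_norm_le[OF norm_tree_deriv_shift_resolvent_le[OF assms(1,2) this]]
    show ?thesis by simp
  qed
  then have "bounded_operator_on X (Lipschitz_norm E r) (shift_resolvent E r z)"
    unfolding bounded_operator_on_def
    using shift_resolvent_in_space[OF assms(1,2) X] shift_resolvent_linear[OF assms(1) z] by blast
  then show ?thesis
    unfolding spectrum_on_def
    using shift_resolvent_minus_scalar[OF assms(1) z] minus_scalar_shift_resolvent[OF assms(1) z]
    by blast
qed

section \<open>Failure of surjectivity on the closed disk\<close>

text \<open>
  The factors \<open>1 / z\<close> of the recursion rotate by \<open>cnj (sgn z)\<close>; giving the right-hand side the
  same rotation makes all contributions add up without cancellation, and since \<open>|z| \<le> 1\<close> their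
  sizes do not shrink.
\<close>
lemma harmonic_growth:
  assumes "is_tree E" "z \<noteq> 0" "norm z \<le> 1"
    and eq: "\<And>v. minus_scalar (forward_shift E r) z g v =
      cnj (sgn z) ^ depth E r v / of_nat (Suc (depth E r v))"
  shows "harm (Suc (depth E r v)) \<le> norm (g v)"
proof -
  define u where "u = sgn z"
  have nu: "norm u = 1" using assms(2) by (simp add: u_def norm_sgn)
  have zu: "z = of_real (norm z) * u"
    using assms(2) by (simp add: u_def sgn_div_norm scaleR_conv_of_real)
  have u1: "u ^ d * cnj u ^ d = 1" for d
    using nu by (simp add: power_mult_distrib[symmetric] complex_norm_square[symmetric])
  have step_bound: "Re (u ^ Suc d * g v) \<le> - (H + inverse (real (Suc d)))"
    if d: "depth E r v = d" and H: "0 \<le> H" and IH: "Re (u ^ d * forward_shift E r g v) \<le> - H"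
    for v d H
  proof -
    have "z * g v = forward_shift E r g v - cnj u ^ d / of_nat (Suc d)"
      using eq[of v] d by (simp add: minus_scalar_def u_def algebra_simps)
    then have "u ^ d * (z * g v) = u ^ d * forward_shift E r g v - inverse (of_nat (Suc d))"
      using u1[of d] by (simp add: right_diff_distrib divide_inverse mult.assoc[symmetric])
    moreover have "u ^ d * (z * g v) = of_real (norm z) * (u ^ Suc d * g v)"
      by (subst (1) zu) (simp add: mult_ac)
    ultimately have "of_real (norm z) * (u ^ Suc d * g v) =
        u ^ d * forward_shift E r g v - of_real (inverse (real (Suc d)))"
      by simp
    then have "Re (of_real (norm z) * (u ^ Suc d * g v)) =
        Re (u ^ d * forward_shift E r g v - of_real (inverse (real (Suc d))))"
      by (rule arg_cong)
    then have "norm z * Re (u ^ Suc d * g v) =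
        Re (u ^ d * forward_shift E r g v) - inverse (real (Suc d))"
      by (simp only: Re_complex_of_real Im_complex_of_real times_complex.sel minus_complex.sel)
    then have *: "norm z * Re (u ^ Suc d * g v) \<le> - (H + inverse (real (Suc d)))"
      using IH by simp
    have pos: "0 < H + inverse (real (Suc d))" using H by (intro add_nonneg_pos) auto
    have neg: "Re (u ^ Suc d * g v) < 0"
    proof (rule ccontr)
      assume "\<not> ?thesis"
      then have "0 \<le> norm z * Re (u ^ Suc d * g v)" by (intro mult_nonneg_nonneg) auto
      with * pos show False by linarith
    qed
    have "Re (u ^ Suc d * g v) \<le> norm z * Re (u ^ Suc d * g v)"
      using neg mult_right_mono_neg[OF assms(3), of "Re (u ^ Suc d * g v)"] by simp
    with * show ?thesis by linarith
  qed
  have "Re (u ^ Suc (depth E r v) * g v) \<le> - harm (Suc (depth E r v))"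
    using assms(1)
  proof (induction v rule: tree_induct[where r = r])
    case root
    show ?case
      using step_bound[of r 0 0] depth_root[OF assms(1), of r]
      by (simp add: forward_shift_def harm_Suc harm_expand)
  next
    case (step v)
    show ?case
      using step_bound[of v "Suc (depth E r (parent E r v))"
          "harm (Suc (depth E r (parent E r v)))"] step harm_nonneg[where ?'a = real]
        depth_parent[OF assms(1) step(1)]
      by (simp add: forward_shift_def harm_Suc del: power_Suc)
  qed
  then have "harm (Suc (depth E r v)) \<le> norm (u ^ Suc (depth E r v) * g v)"
    using abs_Re_le_cmod[of "u ^ Suc (depth E r v) * g v"] by linarith
  then show ?thesis by (simp add: norm_mult norm_power nu del: power_Suc)
qed

lemma in_spectrum_closed_disk:
  fixes E :: "'v \<Rightarrow> 'v \<Rightarrow> bool"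
  assumes "is_tree E" "locally_finite E" "infinite (UNIV :: 'v set)" "norm z \<le> 1"
    and X: "X \<in> {Lipschitz_space E r, little_Lipschitz_space E r}"
  shows "z \<in> spectrum_on X (Lipschitz_norm E r) (forward_shift E r)"
proof -
  define k where "k = (\<lambda>v. cnj (sgn z) ^ depth E r v / of_nat (Suc (depth E r v)))"
  define h where "h = path_sum E r k"
  have k_le: "norm (k v) \<le> 1 / real (Suc (depth E r v))" for v
  proof -
    have "norm (cnj (sgn z) ^ depth E r v) \<le> 1"
      unfolding norm_power complex_mod_cnj norm_sgn by (intro power_le_one) auto
    then show ?thesis
      unfolding k_def norm_divide norm_of_nat by (intro divide_right_mono) auto
  qed
  have "h \<in> little_Lipschitz_space E r"
    unfolding h_def
  proof (rule path_sum_in_little_Lipschitz_space[OF assms(1), where K = 1])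
    show "norm (k v) \<le> 1" for v
      using order_trans[OF k_le[of v]] by simp
    fix e :: real assume "0 < e"
    then obtain n where n: "1 / real (Suc n) < e" using nat_approx_posE by blast
    have "norm (k v) < e" if "n \<le> depth E r v" for v
    proof -
      have "1 / real (Suc (depth E r v)) \<le> 1 / real (Suc n)"
        using that by (simp add: frac_le)
      then show ?thesis using k_le[of v] n by linarith
    qed
    then show "\<exists>n. \<forall>v. n \<le> depth E r v \<longrightarrow> norm (k v) < e" by blast
  qed
  then have hX: "h \<in> X" using X little_subset_Lipschitz_space[of E r] by auto
  have "minus_scalar (forward_shift E r) z f \<noteq> h" if f: "f \<in> Lipschitz_space E r" for f
  proof
    assume "minus_scalar (forward_shift E r) z f = h"
    then have eq: "minus_scalar (forward_shift E r) z (tree_deriv E r f) = k"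
      by (metis h_def tree_deriv_minus_scalar_forward_shift tree_deriv_path_sum[OF assms(1)])
    show False
    proof (cases "z = 0")
      case True
      \<comment> \<open>A shifted function vanishes at the root, whereas \<open>k r = 1\<close>.\<close>
      then show ?thesis
        using fun_cong[OF eq, of r]
        by (simp add: k_def minus_scalar_def forward_shift_def depth_root[OF assms(1)])
    next
      case False
      have growth: "harm (Suc (depth E r v)) \<le> Lipschitz_norm E r f" for v
        using harmonic_growth[OF assms(1) False assms(4), of r "tree_deriv E r f" v]
          fun_cong[OF eq] norm_tree_deriv_le[OF f, of v] by (simp add: k_def)
      have "filterlim (harm :: nat \<Rightarrow> real) at_top sequentially" by (rule harm_at_top)
      then obtain n where n: "\<And>m. n \<le> m \<Longrightarrow> Lipschitz_norm E r f < harm m"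
        unfolding filterlim_at_top_dense eventually_sequentially by blast
      obtain v where "n < depth E r v" by (rule depth_unbounded[OF assms(1-3)])
      then show False using n[of "Suc (depth E r v)"] growth[of v] by simp
    qed
  qed
  moreover have "X \<subseteq> Lipschitz_space E r"
    using X little_subset_Lipschitz_space[of E r] by auto
  ultimately show ?thesis
    using hX unfolding spectrum_on_def bounded_operator_on_def by blast
qed

section \<open>The approximate point spectrum\<close>

lemma bounded_below_outside_disk:
  assumes "1 < norm z" and X: "X \<subseteq> Lipschitz_space E r"
  shows "bounded_below_on X (Lipschitz_norm E r) (minus_scalar (forward_shift E r) z)"
proof -
  have "(norm z - 1) * Lipschitz_norm E r f \<le>
      Lipschitz_norm E r (minus_scalar (forward_shift E r) z f)" if "f \<in> X" for f
  proof -
    have f: "f \<in> Lipschitz_space E r" using that X by blast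
    let ?N = "Lipschitz_norm E r f" and ?M = "Lipschitz_norm E r (minus_scalar (forward_shift E r) z f)"
    have "norm (tree_deriv E r f v) \<le> (?N + ?M) / norm z" for v
    proof -
      have "norm (tree_deriv E r f v) \<le>
          (norm (forward_shift E r (tree_deriv E r f) v) + ?M) / norm z"
        using norm_tree_deriv_le[OF minus_scalar_forward_shift_Lipschitz[OF f]]
        by (intro minus_scalar_shift_norm_step[OF assms(1)])
          (simp add: tree_deriv_minus_scalar_forward_shift)
      also have "\<dots> \<le> (?N + ?M) / norm z"
        using norm_tree_deriv_le[OF f] Lipschitz_norm_nonneg[OF f]
        by (intro divide_right_mono) (auto simp: forward_shift_def)
      finally show ?thesis .
    qed
    then have "?N \<le> (?N + ?M) / norm z" by (rule Lipschitz_norm_le)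
    then have "?N * norm z \<le> ?N + ?M" using assms(1) by (subst (asm) pos_le_divide_eq) auto
    then show ?thesis by (simp add: algebra_simps)
  qed
  then show ?thesis
    unfolding bounded_below_on_def using assms(1) by (intro exI[of _ "norm z - 1"]) auto
qed

text \<open>Every value \<open>f' v\<close> is a value of \<open>(S f)'\<close> at a child of \<open>v\<close>, so \<open>S\<close> is isometric.\<close>
lemma bounded_below_inside_disk:
  assumes "leafless E r" "norm z < 1" and X: "X \<subseteq> Lipschitz_space E r"
  shows "bounded_below_on X (Lipschitz_norm E r) (minus_scalar (forward_shift E r) z)"
proof -
  have "(1 - norm z) * Lipschitz_norm E r f \<le>
      Lipschitz_norm E r (minus_scalar (forward_shift E r) z f)" if "f \<in> X" for f
  proof -
    have f: "f \<in> Lipschitz_space E r" using that X by blast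
    let ?N = "Lipschitz_norm E r f" and ?M = "Lipschitz_norm E r (minus_scalar (forward_shift E r) z f)"
    have "norm (tree_deriv E r f v) \<le> ?M + norm z * ?N" for v
    proof -
      obtain w where w: "w \<noteq> r" "parent E r w = v"
        using assms(1) unfolding leafless_def children_def by blast
      have "tree_deriv E r f v =
          tree_deriv E r (minus_scalar (forward_shift E r) z f) w + z * tree_deriv E r f w"
        using w by (simp add: tree_deriv_minus_scalar_forward_shift minus_scalar_def
            forward_shift_def)
      also have "norm \<dots> \<le> ?M + norm z * ?N"
        using norm_tree_deriv_le[OF minus_scalar_forward_shift_Lipschitz[OF f], of z w]
          norm_tree_deriv_le[OF f, of w]
        by (intro norm_triangle_le add_mono) (auto simp: norm_mult intro: mult_left_mono)
      finally show ?thesis .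
    qed
    then have "?N \<le> ?M + norm z * ?N" by (rule Lipschitz_norm_le)
    then show ?thesis by (simp add: algebra_simps)
  qed
  then show ?thesis
    unfolding bounded_below_on_def using assms(2) by (intro exI[of _ "1 - norm z"]) auto
qed

text \<open>
  Approximate eigenvectors: the derivative is \<open>z ^ (-|v|)\<close> times a tent function of the depth that
  rises with slope \<open>1 / (n + 1)\<close> to the value \<open>1\<close> at depth \<open>n\<close> and then falls to \<open>0\<close>. The shift
  moves the tent by one level, which changes it by at most its slope.
\<close>
lemma not_bounded_below_unit_circle:
  fixes E :: "'v \<Rightarrow> 'v \<Rightarrow> bool"
  assumes "is_tree E" "locally_finite E" "infinite (UNIV :: 'v set)" "norm z = 1"
    and X: "little_Lipschitz_space E r \<subseteq> X"
  shows "\<not> bounded_below_on X (Lipschitz_norm E r) (minus_scalar (forward_shift E r) z)"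
proof
  assume "bounded_below_on X (Lipschitz_norm E r) (minus_scalar (forward_shift E r) z)"
  then obtain c where c: "0 < c"
    "\<And>f. f \<in> X \<Longrightarrow> c * Lipschitz_norm E r f \<le>
      Lipschitz_norm E r (minus_scalar (forward_shift E r) z f)"
    unfolding bounded_below_on_def by blast
  obtain m where m: "1 / real (Suc m) < c" using c(1) nat_approx_posE by blast
  obtain v0 where v0: "m < depth E r v0" by (rule depth_unbounded[OF assms(1-3)])
  define n where "n = depth E r v0"
  define t where "t = (\<lambda>d. max 0 (1 - \<bar>real d - real n\<bar> / real (Suc n)))"
  define g where "g = (\<lambda>v. inverse z ^ depth E r v * of_real (t (depth E r v)))"
  define f where "f = path_sum E r g"
  have Df: "tree_deriv E r f = g" by (simp add: f_def tree_deriv_path_sum[OF assms(1)])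
  have z: "z \<noteq> 0" using assms(4) by auto
  have t01: "0 \<le> t d" "t d \<le> 1" for d by (auto simp: t_def)
  have norm_g: "norm (g v) = t (depth E r v)" for v
    using t01 assms(4) by (simp add: g_def norm_mult norm_power norm_inverse)
  have t_far: "t d = 0" if "2 * n + 1 \<le> d" for d
    using that by (simp add: t_def field_simps)
  have "f \<in> little_Lipschitz_space E r"
    unfolding f_def
  proof (rule path_sum_in_little_Lipschitz_space[OF assms(1), where K = 1])
    show "norm (g v) \<le> 1" for v by (simp add: norm_g t01)
    show "\<exists>n. \<forall>v. n \<le> depth E r v \<longrightarrow> norm (g v) < e" if "0 < e" for e
      using that by (intro exI[of _ "2 * n + 1"]) (simp add: norm_g t_far)
  qed
  then have fX: "f \<in> X" and fL: "f \<in> Lipschitz_space E r"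
    using X little_subset_Lipschitz_space[of E r] by auto
  have "norm (tree_deriv E r f v0) = 1" by (simp add: Df norm_g t_def flip: n_def)
  then have "1 \<le> Lipschitz_norm E r f" using norm_tree_deriv_le[OF fL, of v0] by simp
  then have "c \<le> c * Lipschitz_norm E r f" using c(1) by simp
  also have "\<dots> \<le> Lipschitz_norm E r (minus_scalar (forward_shift E r) z f)" by (rule c(2)[OF fX])
  also have "\<dots> \<le> 1 / real (Suc n)"
  proof (rule Lipschitz_norm_le)
    fix v
    have "norm (forward_shift E r g v - z * g v) \<le> 1 / real (Suc n)"
    proof (cases "v = r")
      case True
      \<comment> \<open>At the root the shift contributes \<open>0\<close>, and the tent starts at \<open>1 / (n + 1)\<close>.\<close>
      have "t 0 = 1 / real (Suc n)" by (simp add: t_def field_simps)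
      then show ?thesis
        using True assms(4) norm_g[of r]
        by (simp add: forward_shift_def norm_mult depth_root[OF assms(1)])
    next
      case False
      let ?d = "depth E r (parent E r v)"
      have "forward_shift E r g v - z * g v =
          inverse z ^ ?d * of_real (t ?d - t (Suc ?d))"
        using False z depth_parent[OF assms(1) False]
        by (simp add: forward_shift_def g_def algebra_simps)
      then have "norm (forward_shift E r g v - z * g v) = \<bar>t ?d - t (Suc ?d)\<bar>"
        using assms(4) by (simp add: norm_mult norm_power norm_inverse del: of_real_diff)
      also have "\<dots> \<le> \<bar>\<bar>real (Suc ?d) - real n\<bar> / real (Suc n) - \<bar>real ?d - real n\<bar> / real (Suc n)\<bar>"
        unfolding t_def by linarith
      also have "\<dots> \<le> 1 / real (Suc n)"
        unfolding diff_divide_distrib[symmetric] abs_divide abs_of_nat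
        by (intro divide_right_mono) auto
      finally show ?thesis .
    qed
    then show "norm (tree_deriv E r (minus_scalar (forward_shift E r) z f) v) \<le> 1 / real (Suc n)"
      by (simp add: tree_deriv_minus_scalar_forward_shift Df minus_scalar_def)
  qed
  also have "\<dots> \<le> 1 / real (Suc m)" using v0 by (simp add: n_def frac_le)
  finally show False using m by simp
qed

theorem theorem3p6:
  fixes E :: "'v \<Rightarrow> 'v \<Rightarrow> bool" and r :: 'v
  assumes "is_tree E"
    and "locally_finite E"
    and "countable (UNIV :: 'v set)"
    and "infinite (UNIV :: 'v set)"
  shows "\<forall>X \<in> {Lipschitz_space E r, little_Lipschitz_space E r}.
           spectrum_on X (Lipschitz_norm E r) (forward_shift E r) = closure (ball 0 1) \<and>
           (leafless E r \<longrightarrow>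
             approx_point_spectrum_on X (Lipschitz_norm E r) (forward_shift E r)
               = frontier (ball 0 1))"
proof (intro ballI conjI impI)
  fix X assume X: "X \<in> {Lipschitz_space E r, little_Lipschitz_space E r}"
  have sub: "little_Lipschitz_space E r \<subseteq> X" "X \<subseteq> Lipschitz_space E r"
    using X little_subset_Lipschitz_space[of E r] by auto
  show "spectrum_on X (Lipschitz_norm E r) (forward_shift E r) = closure (ball 0 1)"
  proof (rule set_eqI)
    fix z
    show "z \<in> spectrum_on X (Lipschitz_norm E r) (forward_shift E r) \<longleftrightarrow> z \<in> closure (ball 0 1)"
      using in_spectrum_closed_disk[OF assms(1,2,4) _ X, of z]
        not_in_spectrum_outside_disk[OF assms(1) _ X, of z]
      by (cases "norm z \<le> 1") auto
  qed
  assume leafless: "leafless E r"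
  show "approx_point_spectrum_on X (Lipschitz_norm E r) (forward_shift E r) = frontier (ball 0 1)"
  proof (rule set_eqI)
    fix z
    show "z \<in> approx_point_spectrum_on X (Lipschitz_norm E r) (forward_shift E r) \<longleftrightarrow>
        z \<in> frontier (ball 0 1)"
      unfolding approx_point_spectrum_on_def
      using not_bounded_below_unit_circle[OF assms(1,2,4) _ sub(1), of z]
        bounded_below_inside_disk[OF leafless _ sub(2), of z]
        bounded_below_outside_disk[OF _ sub(2), of z]
      by (cases "norm z" "1 :: real" rule: linorder_cases) auto
  qed
qed

end
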